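(* Let $n,k,c,t$ be positive integers with $n=ck$ and $t\le c$. If there exists a resolvable $t$-$(n,c,1)$ design, then the size of the largest partially $t$-intersecting uniform $k$-partition system from $\mathcal{U}^n_k$ is bounded above by $$\frac{1}{(k-1)!}\binom{n-t}{c-t}\binom{n-c}{c}\cdots\binom cc=\binom{n-t}{c-t}U(n-c,k-1).$$ Further, this bound is attained by a trivially partially $t$-intersecting $k$-partition system.
   Context: For $n=ck$, $\mathcal{U}^n_k$ is the set of all partitions of $\{1,\dots,n\}$ into $k$ classes each of size $c$, and $U(n,k)=|\mathcal{U}^n_k|=\frac1{k!}\binom nc\binom{n-c}c\cdots\binom cc$. Two partitions $P,Q$ are partially $t$-intersecting if there are classes $P_i\in P$ and $Q_j\in Q$ with $|P_i\cap Q_j|\ge t$. A partially $t$-intersecting uniform $k$-partition system is a set $\mathcal{P}\subseteq\mathcal{U}^n_k$ whose members are pairwise partially $t$-intersecting. A (uniform) trivially partially $t$-intersecting $k$-partition system is a system equal, up to a permutation of $\{1,\dots,n\}$, to $\{P\in\mathcal{U}^n_k:\ \{1,\dots,t\}\subseteq A\text{ for some class }A\in P\}$. For $2\le t\le c<n$, a $t$-$(n,c,1)$ design is a collection of $c$-subsets (blocks) of $\{1,\dots,n\}$ such that every $t$-subset of $\{1,\dots,n\}$ is contained in exactly one block. A parallel class is a set of pairwise disjoint blocks whose union is $\{1,\dots,n\}$. The design is resolvable if its blocks can be partitioned into parallel classes. *)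

theory Defs
  imports Complex_Main "HOL-Library.Disjoint_Sets" "HOL-Combinatorics.Permutations"
begin

(* The class size c is determined by n = c * k. If k does not divide n the set is empty,
   and for n = k = 0 it consists of the empty partition only. *)
definition uniform_partitions :: "nat \<Rightarrow> nat \<Rightarrow> nat set set set" where
  "uniform_partitions n k =
     {P. partition_on {1..n} P \<and> card P = k \<and> (\<forall>A\<in>P. card A = n div k)}"

definition num_uniform_partitions :: "nat \<Rightarrow> nat \<Rightarrow> nat" where
  "num_uniform_partitions n k = card (uniform_partitions n k)"

definition partially_intersecting :: "nat \<Rightarrow> nat set set \<Rightarrow> nat set set \<Rightarrow> bool" where
  "partially_intersecting t P Q \<longleftrightarrow> (\<exists>A\<in>P. \<exists>B\<in>Q. card (A \<inter> B) \<ge> t)"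

definition partially_intersecting_system :: "nat \<Rightarrow> nat \<Rightarrow> nat \<Rightarrow> nat set set set \<Rightarrow> bool" where
  "partially_intersecting_system n k t S \<longleftrightarrow>
     S \<subseteq> uniform_partitions n k \<and> pairwise (partially_intersecting t) S"

definition trivially_intersecting_system :: "nat \<Rightarrow> nat \<Rightarrow> nat \<Rightarrow> nat set set set \<Rightarrow> bool" where
  "trivially_intersecting_system n k t S \<longleftrightarrow>
     (\<exists>\<pi>. \<pi> permutes {1..n} \<and>
          S = (\<lambda>P. (\<lambda>A. \<pi> ` A) ` P) ` {P \<in> uniform_partitions n k. \<exists>A\<in>P. {1..t} \<subseteq> A})"

definition is_design :: "nat \<Rightarrow> nat \<Rightarrow> nat \<Rightarrow> nat set set \<Rightarrow> bool" where
  "is_design t n c D \<longleftrightarrow>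
     2 \<le> t \<and> t \<le> c \<and> c < n \<and>
     (\<forall>A\<in>D. A \<subseteq> {1..n} \<and> card A = c) \<and>
     (\<forall>T. T \<subseteq> {1..n} \<and> card T = t \<longrightarrow> (\<exists>!A. A \<in> D \<and> T \<subseteq> A))"

definition parallel_class :: "nat \<Rightarrow> nat set set \<Rightarrow> nat set set \<Rightarrow> bool" where
  "parallel_class n D C \<longleftrightarrow> C \<subseteq> D \<and> disjoint C \<and> \<Union>C = {1..n}"

definition resolvable :: "nat \<Rightarrow> nat set set \<Rightarrow> bool" where
  "resolvable n D \<longleftrightarrow> (\<exists>R. partition_on D R \<and> (\<forall>C\<in>R. parallel_class n D C))"

definition max_system_size :: "nat \<Rightarrow> nat \<Rightarrow> nat \<Rightarrow> nat" where
  "max_system_size n k t = Max (card ` {S. partially_intersecting_system n k t S})"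

lemma finite_uniform_partitions: "finite (uniform_partitions n k)"
proof (rule finite_subset)
  show "uniform_partitions n k \<subseteq> Pow (Pow {1..n})"
    unfolding uniform_partitions_def by (auto simp: partition_on_def)
qed simp

(* The maximum above is taken over a finite nonempty set. *)
lemma finite_systems: "finite {S. partially_intersecting_system n k t S}"
proof (rule finite_subset)
  show "{S. partially_intersecting_system n k t S} \<subseteq> Pow (uniform_partitions n k)"
    unfolding partially_intersecting_system_def by auto
qed (simp add: finite_uniform_partitions)

lemma systems_nonempty: "{S. partially_intersecting_system n k t S} \<noteq> {}"
proof -
  have "partially_intersecting_system n k t {}"
    by (simp add: partially_intersecting_system_def)
  then show ?thesis by blast
qed

end

theory Submission
  imports Defs
begin

text \<open>
  The upper bound is an instance of the clique--coclique principle. The symmetric group acts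
  transitively on the partitions of a set into classes of size \<open>c\<close>, and it preserves
  the relation of being partially \<open>t\<close>-intersecting. Two distinct parallel classes of a resolution
  consist of distinct blocks of the design, and distinct blocks share fewer than \<open>t\<close> points, so the
  resolution \<open>R\<close> is a family of partitions no two of which are partially \<open>t\<close>-intersecting. Hence every
  image of \<open>R\<close> under a permutation contains at most one member of an intersecting system \<open>S\<close>.
  Averaging over all permutations turns this into \<open>|S| * |R| \<le> U(n,k)\<close>
  (lemma \<open>clique_coclique_bound\<close>).

  It remains to evaluate \<open>U(n,k) / |R|\<close>. Counting \<open>t\<close>-subsets by the block that contains them gives
  \<open>|D| * (c choose t) = (n choose t)\<close>, and \<open>|D| = k * |R|\<close>. Splitting a partition into the class
  that contains a given nonempty set and a partition of the remaining points
  (lemma \<open>card_equipartitions_class_superset\<close>) yields both the product formula for \<open>U\<close> and the size of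
  the trivially intersecting system. With
  \<open>(n choose c) * (c choose t) = (n choose t) * ((n - t) choose (c - t))\<close>, the quotient is exactly the
  size of the trivially intersecting system, which is therefore of maximum size.
\<close>

section \<open>Partitions into classes of equal size\<close>

text \<open>
  Removing a class leaves a partition of an arbitrary finite set, so the counting recursion needs
  partitions of sets other than the initial segments \<open>{1..n}\<close>.
\<close>

definition equipartitions :: "'a set \<Rightarrow> nat \<Rightarrow> 'a set set set" where
  "equipartitions V c = {P. partition_on V P \<and> (\<forall>A\<in>P. card A = c)}"

lemma finite_equipartitions:
  assumes "finite V"
  shows "finite (equipartitions V c)"
  using finitely_many_partition_on[OF assms] by (simp add: equipartitions_def)

lemma card_equipartition:
  assumes "finite V" "P \<in> equipartitions V c"
  shows "c * card P = card V"
proof -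
  have p: "partition_on V P" and c: "\<forall>A\<in>P. card A = c"
    using assms(2) by (auto simp: equipartitions_def)
  have fP: "finite P" using assms(1) p by (rule finite_elements)
  have "card V = card (\<Union>P)" using p by (simp add: partition_on_def)
  also have "\<dots> = sum card P"
    using p fP assms(1)
    by (intro card_Union_disjoint) (auto simp: partition_on_def disjoint_def pairwise_def disjnt_def
         intro: finite_subset)
  also have "\<dots> = c * card P" using c by simp
  finally show ?thesis by simp
qed

lemma uniform_partitions_eq_equipartitions:
  assumes "c > 0" "k > 0"
  shows "uniform_partitions (c * k) k = equipartitions {1..c * k} c"
proof -
  have "card P = k" if "P \<in> equipartitions {1..c * k} c" for P
    using card_equipartition[OF _ that] assms by simp
  then show ?thesis
    using assms by (auto simp: uniform_partitions_def equipartitions_def)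
qed

lemma card_supersets_of_card:
  assumes "finite V" "T \<subseteq> V" "card T \<le> c"
  shows "card {A. T \<subseteq> A \<and> A \<subseteq> V \<and> card A = c} = (card V - card T) choose (c - card T)"
proof -
  have fT: "finite T" using assms finite_subset by blast
  have "bij_betw (\<lambda>A. A - T) {A. T \<subseteq> A \<and> A \<subseteq> V \<and> card A = c}
          {B. B \<subseteq> V - T \<and> card B = c - card T}"
  proof (rule bij_betw_byWitness[where f' = "\<lambda>B. B \<union> T"])
    show "(\<lambda>B. B \<union> T) ` {B. B \<subseteq> V - T \<and> card B = c - card T}
        \<subseteq> {A. T \<subseteq> A \<and> A \<subseteq> V \<and> card A = c}"
    proof clarify
      fix B assume B: "B \<subseteq> V - T" "card B = c - card T"
      have "finite B" using B(1) assms(1) finite_subset by blast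
      moreover have "B \<inter> T = {}" using B(1) by blast
      ultimately have "card (B \<union> T) = c"
        using fT B(2) assms(3) by (simp add: card_Un_disjoint)
      then show "T \<subseteq> B \<union> T \<and> B \<union> T \<subseteq> V \<and> card (B \<union> T) = c" using B assms by auto
    qed
    show "(\<lambda>A. A - T) ` {A. T \<subseteq> A \<and> A \<subseteq> V \<and> card A = c}
        \<subseteq> {B. B \<subseteq> V - T \<and> card B = c - card T}"
      using fT by (auto simp: card_Diff_subset)
  qed auto
  then have "card {A. T \<subseteq> A \<and> A \<subseteq> V \<and> card A = c} = card {B. B \<subseteq> V - T \<and> card B = c - card T}"
    by (rule bij_betw_same_card)
  also have "\<dots> = card (V - T) choose (c - card T)"
    using assms by (intro n_subsets) auto
  finally show ?thesis using fT assms(2) by (simp add: card_Diff_subset)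
qed

lemma equipartition_remove_class:
  assumes "A \<subseteq> V" "card A = c" "c > 0"
  shows "bij_betw (insert A) (equipartitions (V - A) c) {P \<in> equipartitions V c. A \<in> P}"
proof (rule bij_betw_byWitness[where f' = "\<lambda>P. P - {A}"])
  have ne: "A \<noteq> {}" using assms by auto
  have notin: "A \<notin> Q" if "Q \<in> equipartitions (V - A) c" for Q
    using that ne by (auto simp: equipartitions_def partition_on_def)
  show "\<forall>Q\<in>equipartitions (V - A) c. insert A Q - {A} = Q" using notin by simp
  have split: "partition_on V (insert A Q) \<longleftrightarrow> partition_on (V - A) Q" if "A \<inter> \<Union>Q = {}" for Q
    using that partition_on_insert[of A Q V] assms(1) ne by (simp add: disjnt_def)
  show "insert A ` equipartitions (V - A) c \<subseteq> {P \<in> equipartitions V c. A \<in> P}"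
  proof clarify
    fix Q assume Q: "Q \<in> equipartitions (V - A) c"
    then have "A \<inter> \<Union>Q = {}" by (auto simp: equipartitions_def partition_on_def)
    then show "insert A Q \<in> equipartitions V c \<and> A \<in> insert A Q"
      using Q split assms(2) by (simp add: equipartitions_def)
  qed
  show "(\<lambda>P. P - {A}) ` {P \<in> equipartitions V c. A \<in> P} \<subseteq> equipartitions (V - A) c"
  proof clarify
    fix P assume P: "P \<in> equipartitions V c" "A \<in> P"
    then have "disjoint P" by (simp add: equipartitions_def partition_on_def)
    then have "A \<inter> \<Union>(P - {A}) = {}" using P(2) unfolding disjoint_def by blast
    moreover have "insert A (P - {A}) = P" using P(2) by blast
    ultimately show "P - {A} \<in> equipartitions (V - A) c"
      using P split[of "P - {A}"] by (simp add: equipartitions_def)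
  qed
qed auto

text \<open>
  A nonempty set lies in at most one class of a partition, so these partitions are classified by
  that class together with what they induce on its complement.
\<close>

lemma card_equipartitions_class_superset:
  assumes fV: "finite V" and "T \<noteq> {}" "c > 0"
  shows "card {P \<in> equipartitions V c. \<exists>A\<in>P. T \<subseteq> A}
       = (\<Sum>A | T \<subseteq> A \<and> A \<subseteq> V \<and> card A = c. card (equipartitions (V - A) c))"
proof -
  let ?I = "{A. T \<subseteq> A \<and> A \<subseteq> V \<and> card A = c}"
  let ?F = "\<lambda>A. {P \<in> equipartitions V c. A \<in> P}"
  have "{P \<in> equipartitions V c. \<exists>A\<in>P. T \<subseteq> A} = (\<Union>A\<in>?I. ?F A)"
    by (auto simp: equipartitions_def partition_on_def)
  also have "card \<dots> = (\<Sum>A\<in>?I. card (?F A))"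
  proof (rule card_UN_disjoint)
    show "finite ?I" using fV by (auto intro: finite_subset[of _ "Pow V"])
    show "\<forall>A\<in>?I. finite (?F A)" using finite_equipartitions[OF fV] by simp
    show "\<forall>A\<in>?I. \<forall>B\<in>?I. A \<noteq> B \<longrightarrow> ?F A \<inter> ?F B = {}"
    proof (intro ballI impI)
      fix A B assume AB: "A \<in> ?I" "B \<in> ?I" "A \<noteq> B"
      then have "A \<inter> B \<noteq> {}" using \<open>T \<noteq> {}\<close> by blast
      then have "\<not> (A \<in> P \<and> B \<in> P)" if "P \<in> equipartitions V c" for P
        using that \<open>A \<noteq> B\<close> by (auto simp: equipartitions_def partition_on_def dest: disjointD)
      then show "?F A \<inter> ?F B = {}" by blast
    qed
  qed
  also have "\<dots> = (\<Sum>A\<in>?I. card (equipartitions (V - A) c))"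
  proof (rule sum.cong)
    fix A assume "A \<in> ?I"
    then have "bij_betw (insert A) (equipartitions (V - A) c) (?F A)"
      using assms(3) by (intro equipartition_remove_class) auto
    then show "card (?F A) = card (equipartitions (V - A) c)"
      by (rule bij_betw_same_card[symmetric])
  qed simp
  finally show ?thesis .
qed

lemma mult_binomial_pred:
  assumes "c > 0"
  shows "Suc m * ((c * Suc m - 1) choose (c - 1)) = (c * Suc m) choose c"
proof -
  obtain d where d: "c = Suc d" using assms gr0_implies_Suc by blast
  have "c * Suc m = Suc (c * Suc m - 1)" using assms by simp
  then have "c * ((c * Suc m) choose c) = c * Suc m * ((c * Suc m - 1) choose (c - 1))"
    using Suc_times_binomial_eq[of "c * Suc m - 1" d] d by (metis diff_Suc_1 mult.commute)
  then have "c * ((c * Suc m) choose c) = c * (Suc m * ((c * Suc m - 1) choose (c - 1)))"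
    by (simp only: mult.assoc)
  then show ?thesis using assms by simp
qed

text \<open>
  Choosing the class of one fixed point reduces \<open>m + 1\<close> classes to \<open>m\<close>; the factor \<open>m + 1\<close> from the
  factorial turns the number of choices into \<open>(c * (m + 1)) choose c\<close>.
\<close>

lemma fact_mult_card_equipartitions:
  assumes "finite V" "card V = c * m" "c > 0"
  shows "fact m * card (equipartitions V c) = (\<Prod>j=1..m. (c * j) choose c)"
  using assms(1,2)
proof (induction m arbitrary: V)
  case 0
  then have "equipartitions V c = {{}}"
    by (auto simp: equipartitions_def partition_on_def)
  then show ?case by simp
next
  case (Suc m)
  from Suc.prems assms(3) obtain x where x: "x \<in> V" by fastforce
  let ?I = "{A. {x} \<subseteq> A \<and> A \<subseteq> V \<and> card A = c}"
  have I: "card ?I = (c * Suc m - 1) choose (c - 1)"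
    using card_supersets_of_card[of V "{x}" c] Suc.prems x assms(3) by simp
  have "equipartitions V c = {P \<in> equipartitions V c. \<exists>A\<in>P. {x} \<subseteq> A}"
    using x by (auto simp: equipartitions_def partition_on_def)
  then have "card (equipartitions V c) = (\<Sum>A\<in>?I. card (equipartitions (V - A) c))"
    using card_equipartitions_class_superset[of V "{x}" c] Suc.prems assms(3) by simp
  then have "fact m * card (equipartitions V c)
      = (\<Sum>A\<in>?I. fact m * card (equipartitions (V - A) c))"
    by (simp add: sum_distrib_left)
  also have "\<dots> = (\<Sum>A\<in>?I. \<Prod>j=1..m. (c * j) choose c)"
  proof (rule sum.cong)
    fix A assume A: "A \<in> ?I"
    then have "card (V - A) = c * m"
      using Suc.prems by (auto simp: card_Diff_subset finite_subset)
    then show "fact m * card (equipartitions (V - A) c) = (\<Prod>j=1..m. (c * j) choose c)"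
      using Suc.IH[of "V - A"] Suc.prems(1) by simp
  qed simp
  also have "\<dots> = ((c * Suc m - 1) choose (c - 1)) * (\<Prod>j=1..m. (c * j) choose c)"
    using I by simp
  finally have "fact (Suc m) * card (equipartitions V c)
      = Suc m * ((c * Suc m - 1) choose (c - 1)) * (\<Prod>j=1..m. (c * j) choose c)"
    by (simp add: algebra_simps)
  also have "\<dots> = ((c * Suc m) choose c) * (\<Prod>j=1..m. (c * j) choose c)"
    using mult_binomial_pred[OF assms(3)] by simp
  finally show ?case by (simp only: prod.nat_ivl_Suc' le_add1 One_nat_def Suc_le_mono le0)
qed

lemma card_equipartitions_cong:
  assumes "finite V" "finite W" "card V = c * m" "card W = c * m" "c > 0"
  shows "card (equipartitions V c) = card (equipartitions W c)"
proof -
  have "fact m * card (equipartitions V c) = fact m * card (equipartitions W c)"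
    using fact_mult_card_equipartitions assms by metis
  then show ?thesis by simp
qed

lemma card_equipartitions_class_superset_eq:
  assumes "finite V" "card V = c * Suc m" "c > 0" "finite W" "card W = c * m"
    and "T \<subseteq> V" "T \<noteq> {}" "card T \<le> c"
  shows "card {P \<in> equipartitions V c. \<exists>A\<in>P. T \<subseteq> A}
       = ((c * Suc m - card T) choose (c - card T)) * card (equipartitions W c)"
proof -
  let ?I = "{A. T \<subseteq> A \<and> A \<subseteq> V \<and> card A = c}"
  have "card {P \<in> equipartitions V c. \<exists>A\<in>P. T \<subseteq> A}
      = (\<Sum>A\<in>?I. card (equipartitions (V - A) c))"
    using assms by (intro card_equipartitions_class_superset)
  also have "\<dots> = (\<Sum>A\<in>?I. card (equipartitions W c))"
  proof (rule sum.cong)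
    fix A assume A: "A \<in> ?I"
    then have "card (V - A) = c * m"
      using assms(1,2) by (auto simp: card_Diff_subset finite_subset)
    then show "card (equipartitions (V - A) c) = card (equipartitions W c)"
      using card_equipartitions_cong[of "V - A" W c m] assms by simp
  qed simp
  also have "\<dots> = card ?I * card (equipartitions W c)" by simp
  finally show ?thesis using card_supersets_of_card[of V T c] assms by simp
qed

section \<open>The clique--coclique bound\<close>

lemma permutation_maps_equipartition:
  assumes "\<pi> permutes V" "P \<in> equipartitions V c"
  shows "image \<pi> ` P \<in> equipartitions V c"
proof -
  have "inj \<pi>" using assms(1) by (rule permutes_inj)
  have "partition_on (\<pi> ` V) (image \<pi> ` P)"
  proof -
    have p: "partition_on V P" using assms(2) by (simp add: equipartitions_def)
    then have "{} \<notin> image \<pi> ` P" by (auto simp: partition_on_def)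
    then show ?thesis
      using partition_on_inj_image[OF p permutes_inj_on[OF assms(1)]] by simp
  qed
  then show ?thesis
    using assms permutes_image[OF assms(1)] \<open>inj \<pi>\<close>
    by (auto simp: equipartitions_def card_image inj_on_subset[OF \<open>inj \<pi>\<close>])
qed

text \<open>
  Match the classes of the two partitions by a bijection and glue bijections between matched classes;
  surjectivity suffices because the ground set is finite.
\<close>

lemma equipartitions_transitive:
  assumes fV: "finite V" and P: "P \<in> equipartitions V c" and Q: "Q \<in> equipartitions V c" and "c > 0"
  shows "\<exists>\<pi>. \<pi> permutes V \<and> image \<pi> ` P = Q"
proof -
  have pP: "partition_on V P" and pQ: "partition_on V Q"
    and cP: "\<And>A. A \<in> P \<Longrightarrow> card A = c" and cQ: "\<And>A. A \<in> Q \<Longrightarrow> card A = c"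
    using P Q by (auto simp: equipartitions_def)
  have "c * card P = c * card Q"
    using card_equipartition[OF fV P] card_equipartition[OF fV Q] by simp
  then have "card P = card Q" using \<open>c > 0\<close> by simp
  then obtain f where f: "bij_betw f P Q"
    using finite_same_card_bij[of P Q] finite_elements[OF fV pP] finite_elements[OF fV pQ] by blast
  have "\<exists>h. bij_betw h A (f A)" if "A \<in> P" for A
  proof -
    have "f A \<in> Q" using f that by (auto simp: bij_betw_def)
    then have "card A = card (f A)" using cP cQ that by simp
    moreover have "finite A" "finite (f A)"
      using \<open>c > 0\<close> cP[OF that] cQ[OF \<open>f A \<in> Q\<close>] by (auto intro: card_ge_0_finite)
    ultimately show ?thesis using finite_same_card_bij by blast
  qed
  then obtain h where h: "\<And>A. A \<in> P \<Longrightarrow> bij_betw (h A) A (f A)" by metis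
  define \<pi> where "\<pi> v = (if v \<in> V then h (THE A. A \<in> P \<and> v \<in> A) v else v)" for v
  have \<pi>: "\<pi> v = h A v" if "A \<in> P" "v \<in> A" for A v
  proof -
    have "(THE A. A \<in> P \<and> v \<in> A) = A"
      using that pP by (intro the_equality) (auto simp: partition_on_def disjoint_def)
    moreover have "v \<in> V" using that pP by (auto simp: partition_on_def)
    ultimately show ?thesis by (simp add: \<pi>_def)
  qed
  have im: "\<pi> ` A = f A" if "A \<in> P" for A
  proof -
    have "\<pi> ` A = h A ` A" using \<pi>[OF that] by (auto intro: image_cong)
    then show ?thesis using h[OF that] by (simp add: bij_betw_def)
  qed
  have imP: "image \<pi> ` P = Q"
  proof -
    have "image \<pi> ` P = f ` P" using im by (auto intro: image_cong)
    then show ?thesis using f by (simp add: bij_betw_def)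
  qed
  have "\<pi> ` V = \<pi> ` (\<Union>P)" using pP by (simp add: partition_on_def)
  also have "\<dots> = \<Union>(image \<pi> ` P)" by blast
  also have "\<dots> = V" using imP pQ by (simp add: partition_on_def)
  finally have surj: "\<pi> ` V = V" .
  then have "inj_on \<pi> V" using fV by (intro eq_card_imp_inj_on) simp_all
  then have "\<pi> permutes V"
    using surj by (intro bij_imp_permutes) (auto simp: bij_betw_def \<pi>_def)
  with imP show ?thesis by blast
qed

text \<open>
  By transitivity the permutations that carry one partition to another form a coset of a stabilizer,
  and all these cosets have the same size. Only one inequality is stated, because the roles of
  the two pairs can be exchanged.
\<close>

lemma card_transporters_le:
  assumes fV: "finite V" and "c > 0"
    and "P \<in> equipartitions V c" "Q \<in> equipartitions V c"
    and "P' \<in> equipartitions V c" "Q' \<in> equipartitions V c"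
  shows "card {\<pi>. \<pi> permutes V \<and> image \<pi> ` P = Q} \<le> card {\<pi>. \<pi> permutes V \<and> image \<pi> ` P' = Q'}"
proof -
  obtain \<sigma> where \<sigma>: "\<sigma> permutes V" "image \<sigma> ` P' = P"
    using equipartitions_transitive assms by metis
  obtain \<tau> where \<tau>: "\<tau> permutes V" "image \<tau> ` Q = Q'"
    using equipartitions_transitive assms by metis
  show ?thesis
  proof (rule card_inj_on_le[where f = "\<lambda>\<pi>. \<tau> \<circ> \<pi> \<circ> \<sigma>"])
    show "inj_on (\<lambda>\<pi>. \<tau> \<circ> \<pi> \<circ> \<sigma>) {\<pi>. \<pi> permutes V \<and> image \<pi> ` P = Q}"
    proof (rule inj_onI)
      fix \<pi> \<rho> assume eq: "\<tau> \<circ> \<pi> \<circ> \<sigma> = \<tau> \<circ> \<rho> \<circ> \<sigma>"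
      have "\<pi> x = \<rho> x" for x
      proof -
        obtain y where "x = \<sigma> y" using permutes_surj[OF \<sigma>(1)] by blast
        then have "\<tau> (\<pi> x) = \<tau> (\<rho> x)" using fun_cong[OF eq, of y] by simp
        then show ?thesis using permutes_inj[OF \<tau>(1)] by (simp add: inj_eq)
      qed
      then show "\<pi> = \<rho>" by blast
    qed
    show "(\<lambda>\<pi>. \<tau> \<circ> \<pi> \<circ> \<sigma>) ` {\<pi>. \<pi> permutes V \<and> image \<pi> ` P = Q}
        \<subseteq> {\<pi>. \<pi> permutes V \<and> image \<pi> ` P' = Q'}"
    proof clarify
      fix \<pi> assume \<pi>: "\<pi> permutes V" and Q: "Q = image \<pi> ` P"
      have "image (\<tau> \<circ> \<pi> \<circ> \<sigma>) ` P' = image \<tau> ` (image \<pi> ` (image \<sigma> ` P'))"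
        by (simp add: image_image image_comp)
      also have "\<dots> = Q'" using \<sigma>(2) \<tau>(2) Q by simp
      finally show "\<tau> \<circ> \<pi> \<circ> \<sigma> permutes V \<and> image (\<tau> \<circ> \<pi> \<circ> \<sigma>) ` P' = Q'"
        using \<pi> \<sigma>(1) \<tau>(1) by (simp add: permutes_compose)
    qed
    show "finite {\<pi>. \<pi> permutes V \<and> image \<pi> ` P' = Q'}"
      using finite_permutations[OF fV] by (rule rev_finite_subset) auto
  qed
qed

lemma card_transporters_eq:
  assumes "finite V" "c > 0"
    and "P \<in> equipartitions V c" "Q \<in> equipartitions V c"
    and "P' \<in> equipartitions V c" "Q' \<in> equipartitions V c"
  shows "card {\<pi>. \<pi> permutes V \<and> image \<pi> ` P = Q} = card {\<pi>. \<pi> permutes V \<and> image \<pi> ` P' = Q'}"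
  using card_transporters_le[OF assms(1-6)] card_transporters_le[OF assms(1,2,5,6,3,4)]
  by (rule antisym)

text \<open>
  Double counting of the triples \<open>(s, r, \<pi>)\<close> in which \<open>\<pi>\<close> carries \<open>r\<close> to \<open>s\<close>: each pair \<open>(s, r)\<close>
  occurs for the same number \<open>N\<close> of permutations, each permutation occurs at most once, and
  the total number of permutations is \<open>N\<close> times the number of partitions.
\<close>

lemma clique_coclique_bound:
  assumes fV: "finite V" and "c > 0"
    and S: "S \<subseteq> equipartitions V c" and R: "R \<subseteq> equipartitions V c"
    and one: "\<And>\<pi> r r'. \<pi> permutes V \<Longrightarrow> r \<in> R \<Longrightarrow> r' \<in> R \<Longrightarrow>
                image \<pi> ` r \<in> S \<Longrightarrow> image \<pi> ` r' \<in> S \<Longrightarrow> r = r'"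
  shows "card S * card R \<le> card (equipartitions V c)"
proof (cases "R = {}")
  case False
  then obtain r\<^sub>0 where r\<^sub>0: "r\<^sub>0 \<in> R" by blast
  let ?X = "equipartitions V c"
  let ?G = "{\<pi>. \<pi> permutes V}"
  let ?F = "\<lambda>(s, r). {\<pi>. \<pi> permutes V \<and> image \<pi> ` r = s}"
  define N where "N = card (?F (r\<^sub>0, r\<^sub>0))"
  have N: "card (?F (s, r)) = N" if "s \<in> ?X" "r \<in> ?X" for s r
    using card_transporters_eq[OF fV \<open>c > 0\<close>, of r s r\<^sub>0 r\<^sub>0] that r\<^sub>0 R by (auto simp: N_def)
  have fX: "finite ?X" using finite_equipartitions[OF fV] .
  have fG: "finite ?G" using finite_permutations[OF fV] by simp
  have fF: "finite (?F p)" for p using fG by (rule rev_finite_subset) auto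
  have "id \<in> ?F (r\<^sub>0, r\<^sub>0)" by (simp add: permutes_id)
  then have "?F (r\<^sub>0, r\<^sub>0) \<noteq> {}" by (metis empty_iff)
  then have "N > 0" unfolding N_def card_gt_0_iff using fF by (rule conjI)
  have fSR: "finite (S \<times> R)" using S R fX by (auto intro: finite_subset)
  have "card (S \<times> R) * N = (\<Sum>p\<in>S \<times> R. card (?F p))"
    using N S R by (subst sum.cong[where h = "\<lambda>_. N"]) auto
  also have "\<dots> = card (\<Union>p\<in>S \<times> R. ?F p)"
    using one fF fSR by (intro card_UN_disjoint[symmetric]) auto
  also have "\<dots> \<le> card ?G" using fG by (intro card_mono) auto
  also have "?G = (\<Union>p\<in>?X \<times> {r\<^sub>0}. ?F p)"
  proof -
    have "image \<pi> ` r\<^sub>0 \<in> ?X" if "\<pi> permutes V" for \<pi>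
      using permutation_maps_equipartition[OF that] r\<^sub>0 R by blast
    then show ?thesis by auto
  qed
  also have "card \<dots> = (\<Sum>p\<in>?X \<times> {r\<^sub>0}. card (?F p))"
    using fF fX by (intro card_UN_disjoint) auto
  also have "\<dots> = card (?X \<times> {r\<^sub>0}) * N"
    using N r\<^sub>0 R by (subst sum.cong[where h = "\<lambda>_. N"]) auto
  finally have "card S * card R * N \<le> card ?X * N" by (simp add: card_cartesian_product)
  then show ?thesis using \<open>N > 0\<close> by simp
qed simp

section \<open>Resolvable designs\<close>

lemma finite_design:
  assumes "is_design t n c D"
  shows "finite D"
  by (rule finite_subset[of _ "Pow {1..n}"]) (use assms in \<open>auto simp: is_design_def\<close>)

lemma card_inter_design_blocks:
  assumes D: "is_design t n c D" and "A \<in> D" "B \<in> D" and ge: "t \<le> card (A \<inter> B)"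
  shows "A = B"
proof -
  obtain T where T: "T \<subseteq> A \<inter> B" "card T = t" using obtain_subset_with_card_n[OF ge] by blast
  moreover have "A \<subseteq> {1..n}" using D \<open>A \<in> D\<close> by (auto simp: is_design_def)
  ultimately have "T \<subseteq> {1..n}" "card T = t" by auto
  then have "\<exists>!A. A \<in> D \<and> T \<subseteq> A" using D unfolding is_design_def by blast
  then show ?thesis using T assms by blast
qed

lemma card_design:
  assumes D: "is_design t n c D"
  shows "card D * (c choose t) = n choose t"
proof -
  let ?F = "\<lambda>A. {T. T \<subseteq> A \<and> card T = t}"
  have A: "A \<subseteq> {1..n}" "card A = c" "finite A" if "A \<in> D" for A
    using D that by (auto simp: is_design_def intro: finite_subset)
  have "finite D" using D by (rule finite_design)
  have "card D * (c choose t) = (\<Sum>A\<in>D. card (?F A))"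
    using A by (simp add: n_subsets)
  also have "\<dots> = card (\<Union>A\<in>D. ?F A)"
  proof (rule card_UN_disjoint[symmetric])
    show "\<forall>A\<in>D. \<forall>B\<in>D. A \<noteq> B \<longrightarrow> ?F A \<inter> ?F B = {}"
    proof (intro ballI impI, rule ccontr)
      fix A B assume *: "A \<in> D" "B \<in> D" "A \<noteq> B" "?F A \<inter> ?F B \<noteq> {}"
      then obtain T where "T \<subseteq> A \<inter> B" "card T = t" by blast
      then have "t \<le> card (A \<inter> B)" using A(3)[OF *(1)] card_mono by blast
      then show False using card_inter_design_blocks[OF D] * by blast
    qed
  qed (use \<open>finite D\<close> A in auto)
  also have "(\<Union>A\<in>D. ?F A) = {T. T \<subseteq> {1..n} \<and> card T = t}"
  proof (intro equalityI subsetI)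
    fix T assume "T \<in> {T. T \<subseteq> {1..n} \<and> card T = t}"
    moreover from this have "\<exists>!A. A \<in> D \<and> T \<subseteq> A" using D by (simp add: is_design_def)
    ultimately show "T \<in> (\<Union>A\<in>D. ?F A)" by auto
  qed (use A(1) in blast)
  also have "card \<dots> = n choose t" by (simp add: n_subsets)
  finally show ?thesis .
qed

lemma parallel_class_equipartition:
  assumes D: "is_design t n c D" and C: "parallel_class n D C"
  shows "C \<in> equipartitions {1..n} c"
proof -
  have "{} \<notin> D" using D by (auto simp: is_design_def)
  then show ?thesis
    using D C by (auto simp: is_design_def parallel_class_def equipartitions_def partition_on_def)
qed

lemma card_resolution:
  assumes D: "is_design t n c D" and R: "partition_on D R" "\<forall>C\<in>R. parallel_class n D C"
    and n: "n = c * k" "c > 0"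
  shows "card R * k = card D"
proof -
  have "finite D" using D by (rule finite_design)
  moreover have "card C = k" if "C \<in> R" for C
    using card_equipartition[of "{1..n}" C c] parallel_class_equipartition[OF D] R(2) that n by simp
  ultimately show ?thesis
    using card_equipartition[of D R k] R(1) by (auto simp: equipartitions_def mult.commute)
qed

text \<open>
  If two distinct parallel classes had images in \<open>S\<close> under one permutation, then undoing the permutation would
  give a block of each with \<open>t\<close> common points. These blocks would coincide, but parallel classes of a
  resolution share no block.
\<close>

lemma intersecting_system_le_resolution:
  assumes D: "is_design t n c D" and R: "partition_on D R" "\<forall>C\<in>R. parallel_class n D C"
    and "c > 0"
    and S: "S \<subseteq> equipartitions {1..n} c" "pairwise (partially_intersecting t) S"
  shows "card S * card R \<le> card (equipartitions {1..n} c)"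
proof (rule clique_coclique_bound)
  show "R \<subseteq> equipartitions {1..n} c" using parallel_class_equipartition[OF D] R(2) by blast
next
  fix \<pi> r r'
  assume \<pi>: "\<pi> permutes {1..n}" and r: "r \<in> R" "r' \<in> R"
    and rS: "image \<pi> ` r \<in> S" "image \<pi> ` r' \<in> S"
  have inj: "inj \<pi>" using \<pi> by (rule permutes_inj)
  show "r = r'"
  proof (rule ccontr)
    assume ne: "r \<noteq> r'"
    have "inj (image \<pi>)" using inj by (simp add: inj_def inj_image_eq_iff[OF inj])
    then have "image \<pi> ` r \<noteq> image \<pi> ` r'" using ne by (simp add: inj_image_eq_iff)
    then have "partially_intersecting t (image \<pi> ` r) (image \<pi> ` r')"
      using S(2) rS by (auto simp: pairwise_def)
    then obtain A B where AB: "A \<in> r" "B \<in> r'" "t \<le> card (\<pi> ` A \<inter> \<pi> ` B)"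
      by (auto simp: partially_intersecting_def)
    have "card (\<pi> ` A \<inter> \<pi> ` B) = card (A \<inter> B)"
      using inj by (metis image_Int card_image inj_on_subset subset_UNIV)
    moreover have "A \<in> D" "B \<in> D" using R(1) r AB by (auto simp: partition_on_def)
    ultimately have "A = B" using card_inter_design_blocks[OF D] AB(3) by simp
    then have "r \<inter> r' \<noteq> {}" using AB by blast
    then show False using R(1) r ne by (auto simp: partition_on_def disjoint_def)
  qed
qed (use S \<open>c > 0\<close> in auto)

section \<open>The largest intersecting systems\<close>

text \<open>
  This is the identity by which \<open>U(n,k) / |R|\<close> becomes \<open>(n - t choose c - t) * U(n - c, k - 1)\<close>. For
  positive \<open>t\<close> both sides count the pairs of a partition and a \<open>t\<close>-subset of one of its classes. The
  derivation is by trinomial revision from the product formula, where \<open>V\<close> has one more factor than \<open>W\<close>.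
\<close>

lemma card_equipartitions_mult_binomial:
  assumes "finite V" "card V = c * Suc m" "finite W" "card W = c * m" "c > 0" "t \<le> c"
  shows "card (equipartitions V c) * (Suc m * (c choose t))
       = ((c * Suc m) choose t) * (((c * Suc m - t) choose (c - t)) * card (equipartitions W c))"
proof -
  have "fact (Suc m) * card (equipartitions V c)
      = ((c * Suc m) choose c) * (fact m * card (equipartitions W c))"
    unfolding fact_mult_card_equipartitions[OF assms(1,2,5)]
      fact_mult_card_equipartitions[OF assms(3,4,5)] by (simp add: prod.nat_ivl_Suc')
  then have "fact m * (Suc m * card (equipartitions V c))
      = fact m * (((c * Suc m) choose c) * card (equipartitions W c))"
    by (simp only: fact_Suc of_nat_id mult_ac)
  then have "Suc m * card (equipartitions V c) = ((c * Suc m) choose c) * card (equipartitions W c)"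
    by (metis mult_left_cancel fact_nonzero)
  moreover have "((c * Suc m) choose c) * (c choose t)
      = ((c * Suc m) choose t) * ((c * Suc m - t) choose (c - t))"
    using assms by (intro choose_mult) auto
  ultimately show ?thesis by (metis mult.assoc mult.commute)
qed

text \<open>
  The binomial coefficients here come in the opposite order to those of the counting recursion, the
  \<open>i\<close>-th factor being the choice of a class from the \<open>c * (m + 1 - i)\<close> points that remain.
\<close>

lemma prod_binomial_eq_fact_mult:
  assumes "finite W" "card W = c * m" "c > 0"
  shows "(\<Prod>i=1..m. real ((c * Suc m - i * c) choose c)) = fact m * real (card (equipartitions W c))"
proof -
  have "(\<Prod>i=1..m. real ((c * Suc m - i * c) choose c)) = (\<Prod>j=1..m. real ((c * j) choose c))"
  proof (rule prod.reindex_bij_witness[where i = "\<lambda>j. Suc m - j" and j = "\<lambda>i. Suc m - i"])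
    fix i assume "i \<in> {1..m}"
    then show "real ((c * (Suc m - i)) choose c) = real ((c * Suc m - i * c) choose c)"
      by (simp only: diff_mult_distrib2 mult.commute[of i c])
  qed auto
  also have "\<dots> = real (fact m * card (equipartitions W c))"
    by (simp add: fact_mult_card_equipartitions[OF assms])
  finally show ?thesis by simp
qed

lemma trivial_system_intersecting:
  "pairwise (partially_intersecting t) {P \<in> uniform_partitions n k. \<exists>A\<in>P. {1..t} \<subseteq> A}"
proof (rule pairwiseI)
  fix P Q
  assume "P \<in> {P \<in> uniform_partitions n k. \<exists>A\<in>P. {1..t} \<subseteq> A}"
    and "Q \<in> {P \<in> uniform_partitions n k. \<exists>A\<in>P. {1..t} \<subseteq> A}"
  then obtain A B where AB: "A \<in> P" "B \<in> Q" "{1..t} \<subseteq> A \<inter> B" and "partition_on {1..n} P"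
    by (auto simp: uniform_partitions_def)
  then have "A \<subseteq> {1..n}" by (auto simp: partition_on_def)
  then have "finite A" by (rule finite_subset) simp
  then have "card {1..t} \<le> card (A \<inter> B)" using AB by (intro card_mono) auto
  then show "partially_intersecting t P Q" using AB by (auto simp: partially_intersecting_def)
qed

theorem theorem7p5p5:
  fixes n k c t :: nat
  assumes "n > 0" and "k > 0" and "c > 0" and "t > 0"
    and "n = c * k" and "t \<le> c"
    and "\<exists>D. is_design t n c D \<and> resolvable n D"
  shows "real (max_system_size n k t)
           \<le> 1 / fact (k - 1) * real ((n - t) choose (c - t)) * (\<Prod>i=1..k-1. real ((n - i * c) choose c))
       \<and> 1 / fact (k - 1) * real ((n - t) choose (c - t)) * (\<Prod>i=1..k-1. real ((n - i * c) choose c))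
           = real (((n - t) choose (c - t)) * num_uniform_partitions (n - c) (k - 1))
       \<and> (\<exists>S. trivially_intersecting_system n k t S
            \<and> partially_intersecting_system n k t S
            \<and> card S = ((n - t) choose (c - t)) * num_uniform_partitions (n - c) (k - 1))"
proof -
  obtain D R where D: "is_design t n c D"
    and R: "partition_on D R" "\<forall>C\<in>R. parallel_class n D C"
    using assms(7) by (auto simp: resolvable_def)
  have "c < n" using D by (simp add: is_design_def)
  \<comment> \<open>A design has more points than a block, so there are at least two classes, and
      \<open>num_uniform_partitions (n - c) (k - 1)\<close> has class size \<open>c\<close>.\<close>
  then obtain m where k: "k = Suc m" and "m > 0"
    using assms(2,5) by (cases k) auto
  let ?V = "{1..n}"
  let ?W = "{1..c * m}"
  let ?U = "card (equipartitions ?W c)"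
  let ?b = "((n - t) choose (c - t)) * ?U"
  have n: "n = c * Suc m" using assms k by simp
  have V: "uniform_partitions n k = equipartitions ?V c"
    using uniform_partitions_eq_equipartitions[of c k] assms by simp
  have nW: "num_uniform_partitions (n - c) (k - 1) = ?U"
    using uniform_partitions_eq_equipartitions[of c m] \<open>m > 0\<close> assms(3) n k
    by (simp add: num_uniform_partitions_def)
  have bound: "card S \<le> ?b" if S: "partially_intersecting_system n k t S" for S
  proof -
    have "card S * card R \<le> card (equipartitions ?V c)"
      using S V assms(3) D R
      by (intro intersecting_system_le_resolution) (auto simp: partially_intersecting_system_def)
    moreover have "n choose t = card R * (k * (c choose t))"
      using card_design[OF D] card_resolution[OF D R assms(5,3)] by (metis mult.assoc)
    ultimately have "card S * (n choose t) \<le> card (equipartitions ?V c) * (k * (c choose t))"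
      by (metis mult.assoc mult_le_mono1)
    also have "\<dots> = (n choose t) * ?b"
      using card_equipartitions_mult_binomial[of ?V c m ?W t] assms(3,6) n k by simp
    finally have "(n choose t) * card S \<le> (n choose t) * ?b" by (simp only: mult.commute)
    moreover have "n choose t > 0" using assms(6) \<open>c < n\<close> by simp
    ultimately show ?thesis by simp
  qed
  have max: "max_system_size n k t \<le> ?b"
    unfolding max_system_size_def
    using bound finite_systems systems_nonempty by (subst Max_le_iff) auto
  have formula: "1 / fact (k - 1) * real ((n - t) choose (c - t))
      * (\<Prod>i=1..k-1. real ((n - i * c) choose c)) = real ?b"
    using prod_binomial_eq_fact_mult[of ?W c m] assms(3) n k by simp
  define S where "S = {P \<in> uniform_partitions n k. \<exists>A\<in>P. {1..t} \<subseteq> A}"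
  have "trivially_intersecting_system n k t S"
    unfolding trivially_intersecting_system_def S_def
    by (rule exI[of _ id]) (simp add: permutes_id)
  moreover have "partially_intersecting_system n k t S"
    using trivial_system_intersecting
    by (auto simp: partially_intersecting_system_def S_def)
  moreover have "card S = ?b"
    unfolding S_def V
    using card_equipartitions_class_superset_eq[of ?V c m ?W "{1..t}"] assms \<open>c < n\<close> n by simp
  ultimately show ?thesis
    unfolding formula nW using max by (auto simp del: of_nat_mult)
qed

end
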